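(* Let $p$ be a prime, let $k\ge 1$ and let $1\le a_1\le a_2\le\dots\le a_k$ be integers. If $0\le b\le a_1$, then $$h_b^{(a_k,\dots,a_1)}(p)=\prod_{i=2}^{k}\frac{p^{b+i-1}-1}{p^{i-1}-1}.$$ Similarly, if $a_2+\dots+a_k\le b\le a_1+\dots+a_k$, then (replacing $b$ in the formula $\prod_{i=2}^{k}\frac{p^{b+i-1}-1}{p^{i-1}-1}$ by $a_1+\dots+a_k-b$) $$h_b^{(a_k,\dots,a_1)}(p)=\prod_{i=2}^{k}\frac{p^{a_1+\dots+a_k-b+i-1}-1}{p^{i-1}-1}.$$
   Context: $\mathbb{Z}/p^{a}$ denotes the cyclic group of order $p^a$. $h_b^{(a_k,\dots,a_1)}(p)$ denotes the number of subgroups of index $p^b$ (equivalently, of order $p^{a_1+\dots+a_k-b}$) in the abelian $p$-group $\mathbb{Z}/p^{a_1}\times\mathbb{Z}/p^{a_2}\times\cdots\times\mathbb{Z}/p^{a_k}$. Empty sums are $0$ and empty products are $1$. *)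

theory Defs
  imports Complex_Main "HOL-Algebra.Product_Groups" "HOL-Algebra.Coset"
    "HOL-Computational_Algebra.Primes"
begin

definition cyclic_product :: "nat \<Rightarrow> nat \<Rightarrow> (nat \<Rightarrow> nat) \<Rightarrow> (nat \<Rightarrow> int) monoid" where
  "cyclic_product p k a = product_group {1..k} (\<lambda>i. integer_mod_group (p ^ a i))"

(* hsub k a b p is h_b^(a_k,...,a_1)(p); the index of H is its number of cosets.
   Only the values a 1, ..., a k matter. *)
definition hsub :: "nat \<Rightarrow> (nat \<Rightarrow> nat) \<Rightarrow> nat \<Rightarrow> nat \<Rightarrow> nat" where
  "hsub k a b p =
     card {H. subgroup H (cyclic_product p k a) \<and>
              card (rcosets\<^bsub>cyclic_product p k a\<^esub> H) = p ^ b}"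

end

theory Submission
  imports Defs "HOL-Algebra.Multiplicative_Group"
begin

text \<open>
  A subgroup $H$ of $A \times \mathbb{Z}/n$ is determined by the order $e$ of its projection to
  $\mathbb{Z}/n$, the kernel $K = H \cap A$ of this projection, and the coset of $K$ lying over the
  generator $n/e$; this coset can be any element of $A/K$ killed by $e$. Hence the number of
  subgroups of a given order is a sum over $e$ and $K$ of the number of $e$-torsion elements of $A/K$.

  Adjoining the factor $\mathbb{Z}/p^{a_{k+1}}$ to $A = \mathbb{Z}/p^{a_1}\times\cdots\times\mathbb{Z}/p^{a_k}$,
  the torsion is known in both cases. If $H$ has index $p^b$ with $b \le a_{k+1}$, then $K$ has
  index $p^j$ with $j \le b$ and all of the $p^j$ elements of $A/K$ are killed by $e$. If $H$ has
  order $p^m$ with $m \le a_i$ for all $i$ and $e = p^t$, then every element of $K$ is a $p^t$-th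
  multiple, so $A/K$ has as many $p^t$-torsion elements as $A$, namely $p^{kt}$. The two recursions
  in $k$ are summed by the two forms of the $q$-Pascal identity.
\<close>

section \<open>Subgroups of the product of an abelian group and a cyclic group\<close>

text \<open>The subgroup of \<open>A \<times> \<int>/(d * e)\<close> with kernel \<open>K\<close> whose fibre over \<open>d\<close> is the coset \<open>C\<close>.\<close>

definition cyclic_lift ::
    "('a, 'b) monoid_scheme \<Rightarrow> 'a set \<Rightarrow> 'a set \<Rightarrow> nat \<Rightarrow> nat \<Rightarrow> ('a \<times> int) set" where
  "cyclic_lift A K C d e =
     {(z, w). \<exists>j::int. w = (j * int d) mod int (d * e) \<and> z \<in> C [^]\<^bsub>A Mod K\<^esub> j}"

text \<open>Condition \<open>C_pow\<close> makes the fibres well defined: replacing \<open>j\<close>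
  by \<open>j + e\<close> does not change the residue of \<open>j * int d\<close> modulo
  \<open>d * e\<close>, so it must not change the power of \<open>C\<close> either.\<close>

locale cyclic_lift_data = comm_group A for A (structure) +
  fixes K C and d e :: nat
  assumes subgroup_K: "subgroup K A"
    and C_carrier: "C \<in> carrier (A Mod K)"
    and C_pow: "C [^]\<^bsub>A Mod K\<^esub> e = \<one>\<^bsub>A Mod K\<^esub>"
    and d_pos: "0 < d" and e_pos: "0 < e"
begin

sublocale K: normal K A
  by (rule subgroup_imp_normal[OF subgroup_K])

sublocale Q: group "A Mod K"
  by (rule K.factorgroup_is_group)

text \<open>Cancelling \<open>d\<close> turns the congruence modulo \<open>d * e\<close> into
  \<open>i = j\<close> modulo \<open>e\<close>, and the \<open>e\<close>-th power of
  \<open>C\<close> is trivial.\<close>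

lemma C_int_pow_cong:
  assumes "(i * int d) mod int (d * e) = (j * int d) mod int (d * e)"
  shows "C [^]\<^bsub>A Mod K\<^esub> i = C [^]\<^bsub>A Mod K\<^esub> j"
proof -
  have "int d * int e dvd int d * (i - j)"
    using assms unfolding mod_eq_dvd_iff by (simp add: algebra_simps)
  then have "int e dvd i - j"
    using d_pos by simp
  then obtain q where q: "i = int e * q + j"
    by (metis dvdE diff_add_cancel)
  have "C [^]\<^bsub>A Mod K\<^esub> (int e * q) = \<one>\<^bsub>A Mod K\<^esub>"
    using Q.int_pow_pow[OF C_carrier, of "int e" q] C_pow Q.int_pow_one
    by (simp only: int_pow_int)
  then show ?thesis
    unfolding q using Q.int_pow_mult[OF C_carrier] Q.int_pow_closed[OF C_carrier] Q.l_one by metis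
qed

lemma mem_cyclic_lift:
  "(z, (i * int d) mod int (d * e)) \<in> cyclic_lift A K C d e \<longleftrightarrow> z \<in> C [^]\<^bsub>A Mod K\<^esub> i"
  unfolding cyclic_lift_def using C_int_pow_cong by blast

lemma C_int_pow_subset: "C [^]\<^bsub>A Mod K\<^esub> (j::int) \<subseteq> carrier A"
  using Q.int_pow_closed[OF C_carrier] K.rcosets_carrier[OF is_group]
  by (auto simp: FactGroup_def)

text \<open>The fibres over 0 and over \<open>d\<close> give back \<open>K\<close> and
  \<open>C\<close>; this is the part of injectivity that remains once \<open>d\<close> is
  known.\<close>

lemma cyclic_lift_K: "{z. (z, 0) \<in> cyclic_lift A K C d e} = K"
  using mem_cyclic_lift[of _ 0] by auto

lemma cyclic_lift_C: "{z. (z, int d mod int (d * e)) \<in> cyclic_lift A K C d e} = C"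
  using mem_cyclic_lift[of _ 1] Q.int_pow_1[OF C_carrier] by auto

text \<open>Multiplication and inversion in \<open>A Mod K\<close> are the setwise operations on
  cosets, so products and inverses of elements of the fibres stay in the fibres over the
  corresponding multiples of \<open>d\<close>.\<close>

lemma subgroup_cyclic_lift:
  "subgroup (cyclic_lift A K C d e) (A \<times>\<times> integer_mod_group (d * e))" (is "subgroup ?F ?G")
proof -
  interpret G: group ?G
    by (rule DirProd_group[OF is_group group_integer_mod_group])
  have n: "d * e \<noteq> 0" using d_pos e_pos by simp
  show ?thesis
  proof (rule G.subgroupI)
    show sub: "?F \<subseteq> carrier ?G"
      using C_int_pow_subset n d_pos e_pos
      by (auto simp: cyclic_lift_def carrier_integer_mod_group)
    show "?F \<noteq> {}"
      using cyclic_lift_K K.one_closed by blast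
    show "inv\<^bsub>?G\<^esub> u \<in> ?F" if u: "u \<in> ?F" for u
    proof -
      obtain z j where zj: "u = (z, (j * int d) mod int (d * e))" "z \<in> C [^]\<^bsub>A Mod K\<^esub> j"
        using u by (auto simp: cyclic_lift_def)
      have c: "z \<in> carrier A" "(j * int d) mod int (d * e) \<in> carrier (integer_mod_group (d * e))"
        using sub u zj by auto
      have "C [^]\<^bsub>A Mod K\<^esub> (- j) = set_inv (C [^]\<^bsub>A Mod K\<^esub> j)"
        using K.inv_FactGroup[OF Q.int_pow_closed[OF C_carrier]] Q.int_pow_neg[OF C_carrier] by metis
      then have "inv z \<in> C [^]\<^bsub>A Mod K\<^esub> (- j)"
        using zj by (auto simp: SET_INV_def)
      then have "(inv z, (- j * int d) mod int (d * e)) \<in> ?F"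
        by (simp only: mem_cyclic_lift)
      moreover have "inv\<^bsub>?G\<^esub> u = (inv z, (- (j * int d mod int (d * e))) mod int (d * e))"
        unfolding zj using inv_DirProd[OF is_group group_integer_mod_group c] c
        by (simp only: inv_integer_mod_group)
      ultimately show ?thesis
        by (simp only: mod_minus_eq mult_minus_left)
    qed
    show "u \<otimes>\<^bsub>?G\<^esub> v \<in> ?F" if u: "u \<in> ?F" and v: "v \<in> ?F" for u v
    proof -
      obtain z j where zj: "u = (z, (j * int d) mod int (d * e))" "z \<in> C [^]\<^bsub>A Mod K\<^esub> j"
        using u by (auto simp: cyclic_lift_def)
      obtain y i where yi: "v = (y, (i * int d) mod int (d * e))" "y \<in> C [^]\<^bsub>A Mod K\<^esub> i"
        using v by (auto simp: cyclic_lift_def)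
      have "C [^]\<^bsub>A Mod K\<^esub> (j + i) = C [^]\<^bsub>A Mod K\<^esub> j <#> C [^]\<^bsub>A Mod K\<^esub> i"
        using Q.int_pow_mult[OF C_carrier] by simp
      then have "z \<otimes> y \<in> C [^]\<^bsub>A Mod K\<^esub> (j + i)"
        using zj yi by (auto simp: set_mult_def)
      then have "(z \<otimes> y, ((j + i) * int d) mod int (d * e)) \<in> ?F"
        by (simp only: mem_cyclic_lift)
      then show ?thesis
        unfolding zj yi by (simp only: mult_DirProd mult_integer_mod_group mod_add_eq distrib_right)
    qed
  qed
qed

text \<open>There are \<open>e\<close> nonempty fibres, over \<open>0, d, ..., (e - 1) * d\<close>,
  and each is a coset of \<open>K\<close>.\<close>

lemma card_cyclic_lift:
  assumes "finite (carrier A)"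
  shows "card (cyclic_lift A K C d e) = card K * e"
proof -
  have fin: "finite (C [^]\<^bsub>A Mod K\<^esub> (j::int))" for j
    using C_int_pow_subset assms finite_subset by blast
  have card: "card (C [^]\<^bsub>A Mod K\<^esub> (j::int)) = card K" for j
    using card_rcosets_equal[OF _ K.subset] Q.int_pow_closed[OF C_carrier, of j]
    by (simp add: FactGroup_def)
  let ?f = "\<lambda>(j::nat, z). (z, int (j * d))"
  have "cyclic_lift A K C d e = ?f ` (SIGMA j:{0..<e}. C [^]\<^bsub>A Mod K\<^esub> (int j))"
  proof (intro Set.set_eqI iffI)
    fix u assume "u \<in> cyclic_lift A K C d e"
    then obtain z j where zj: "u = (z, (j * int d) mod int (d * e))" "z \<in> C [^]\<^bsub>A Mod K\<^esub> j"
      by (auto simp: cyclic_lift_def)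
    \<comment> \<open>Reducing the exponent modulo \<open>e\<close> gives the representative for
      which \<open>i * d\<close> is already smaller than \<open>d * e\<close>.\<close>
    define i where "i = nat (j mod int e)"
    have i: "int i = j mod int e" "i < e"
      using e_pos by (auto simp: i_def nat_less_iff)
    have *: "(j * int d) mod int (d * e) = int (i * d)"
      by (simp add: i mult.commute[of j] mult.commute[of "j mod int e"] mod_mult_mult1)
    have "(j * int d) mod int (d * e) = (int i * int d) mod int (d * e)"
      using * by (metis mod_mod_trivial of_nat_mult)
    then have "z \<in> C [^]\<^bsub>A Mod K\<^esub> (int i)"
      using C_int_pow_cong zj by blast
    then show "u \<in> ?f ` (SIGMA j:{0..<e}. C [^]\<^bsub>A Mod K\<^esub> (int j))"
      using zj * i by force
  next
    fix u assume "u \<in> ?f ` (SIGMA j:{0..<e}. C [^]\<^bsub>A Mod K\<^esub> (int j))"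
    then obtain j z where jz: "j < e" "z \<in> C [^]\<^bsub>A Mod K\<^esub> (int j)" "u = (z, int (j * d))"
      by auto
    have "(int j * int d) mod int (d * e) = int (j * d)"
      using jz d_pos by (simp add: mult.commute flip: of_nat_mult of_nat_mod)
    then show "u \<in> cyclic_lift A K C d e"
      using mem_cyclic_lift[of z "int j"] jz by (simp add: mult.commute)
  qed
  moreover have "inj_on ?f (SIGMA j:{0..<e}. C [^]\<^bsub>A Mod K\<^esub> (int j))"
    using d_pos by (auto simp: inj_on_def)
  ultimately have "card (cyclic_lift A K C d e) = card (SIGMA j:{0..<e}. C [^]\<^bsub>A Mod K\<^esub> (int j))"
    by (metis card_image)
  also have "\<dots> = card K * e"
    using fin by (simp add: card)
  finally show ?thesis .
qed

end

text \<open>The second lift also contains an element over \<open>d\<close>, so \<open>d\<close> is a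
  multiple of \<open>d'\<close> modulo \<open>d' * e'\<close>, hence a multiple of
  \<open>d'\<close>. Applied in both directions it yields \<open>d = d'\<close>.\<close>

lemma cyclic_lift_d_dvd:
  assumes "cyclic_lift_data A K C d e" and "cyclic_lift_data A K' C' d' e'"
    and "d * e = d' * e'" and "cyclic_lift A K C d e = cyclic_lift A K' C' d' e'"
  shows "d' dvd d"
proof -
  interpret F: cyclic_lift_data A K C d e by fact
  have "C \<noteq> {}"
    using F.C_carrier subgroup.rcosets_non_empty[OF F.subgroup_K] by (auto simp: FactGroup_def)
  then obtain z where "(z, int d mod int (d * e)) \<in> cyclic_lift A K C d e"
    using F.cyclic_lift_C by blast
  then obtain j :: int where "int d mod int (d' * e') = (j * int d') mod int (d' * e')"
    unfolding assms by (auto simp: cyclic_lift_def assms)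
  then have "int d' * int e' dvd int d - j * int d'"
    unfolding mod_eq_dvd_iff by simp
  then have "int d' dvd int d - j * int d'"
    using dvd_mult_left by blast
  then have "int d' dvd int d"
    by (simp add: dvd_diff_left_iff)
  then show ?thesis by simp
qed

text \<open>The projection of \<open>H\<close> to the cyclic factor is generated by its least
  positive representative \<open>d\<close>. The kernel \<open>K\<close> and the coset of any
  \<open>x\<close> lying over \<open>d\<close> then describe \<open>H\<close>.\<close>

lemma (in comm_group) subgroup_eq_cyclic_lift:
  assumes n: "0 < n" and H: "subgroup H (G \<times>\<times> integer_mod_group n)"
  obtains K C d e where "d * e = n" "cyclic_lift_data G K C d e" "H = cyclic_lift G K C d e"
proof -
  let ?P = "G \<times>\<times> integer_mod_group n"
  interpret P: group ?P
    by (rule DirProd_group[OF is_group group_integer_mod_group])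
  interpret H: subgroup H ?P by fact
  have sub: "z \<in> carrier G" "0 \<le> w" "w < int n" if "(z, w) \<in> H" for z w
    using H.subset that n by (auto simp: carrier_integer_mod_group)
  have one: "(\<one>, 0) \<in> H"
    using H.one_closed by simp
  \<comment> \<open>The second coordinates are arbitrary integers reduced modulo \<open>n\<close>,
    so that later computations take place in the integers.\<close>
  have mult: "(y \<otimes> z, (v + w) mod int n) \<in> H" if "(y, v mod int n) \<in> H" "(z, w mod int n) \<in> H" for y z v w
    using H.m_closed[OF that] by (simp add: mod_add_eq)
  have inv: "(inv z, (- w) mod int n) \<in> H" if "(z, w mod int n) \<in> H" for z w
  proof -
    have c: "z \<in> carrier G" "w mod int n \<in> carrier (integer_mod_group n)"
      using H.subset that by auto
    show ?thesis
      using H.m_inv_closed[OF that] inv_DirProd[OF is_group group_integer_mod_group c] c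
      by (simp add: mod_minus_eq)
  qed
  have npow: "(z [^] j, (int j * w) mod int n) \<in> H" if "(z, w mod int n) \<in> H" for z w and j :: nat
  proof (induction j)
    case (Suc j)
    show ?case using mult[OF Suc that] by (simp add: algebra_simps)
  qed (simp add: one)
  have pow: "(z [^] j, (j * w) mod int n) \<in> H" if "(z, w mod int n) \<in> H" for z w and j :: int
  proof (cases j rule: int_cases2)
    case (nonneg m)
    then show ?thesis using npow[OF that, of m] by (simp add: int_pow_int)
  next
    case (nonpos m)
    then show ?thesis
      using inv[OF npow[OF that, of m]] sub(1)[OF that] by (simp add: int_pow_neg_int)
  qed
  define K where "K = {z. (z, 0) \<in> H}"
  have K: "subgroup K G"
  proof (rule subgroupI)
    show "K \<subseteq> carrier G" using sub by (auto simp: K_def)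
    show "K \<noteq> {}" using one by (auto simp: K_def)
    show "inv a \<in> K" if "a \<in> K" for a using inv[of a 0] that by (simp add: K_def)
    show "a \<otimes> b \<in> K" if "a \<in> K" "b \<in> K" for a b using mult[of a 0 b 0] that by (simp add: K_def)
  qed
  \<comment> \<open>Testing the residue of \<open>d\<close> rather than \<open>d\<close> itself
    admits \<open>d = n\<close>, over which the identity lies. A trivial projection thus gives
    \<open>d = n\<close> and \<open>e = 1\<close>.\<close>
  define D where "D = (\<lambda>d::nat. 0 < d \<and> (\<exists>x. (x, int d mod int n) \<in> H))"
  define d where "d = (LEAST d. D d)"
  have "D n" using n one by (auto simp: D_def)
  then have Dd: "D d" unfolding d_def by (rule LeastI)
  have least: "d \<le> m" if "D m" for m
    unfolding d_def using that by (rule Least_le)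
  have d_pos: "0 < d" using Dd by (simp add: D_def)
  obtain x where x: "(x, int d mod int n) \<in> H" using Dd by (auto simp: D_def)
  have xG: "x \<in> carrier G" using sub x by blast
  \<comment> \<open>Otherwise subtracting a multiple of \<open>d\<close> leaves a remainder strictly
    between 0 and \<open>d\<close> that also satisfies \<open>D\<close>, against minimality.\<close>
  have dvd: "int d dvd w" if zw: "(z, w mod int n) \<in> H" for z w
  proof (rule ccontr)
    assume "\<not> int d dvd w"
    define r where "r = w mod int d"
    have r: "0 < r" "r < int d"
      using \<open>\<not> int d dvd w\<close> d_pos pos_mod_bound[of "int d" w] pos_mod_sign[of "int d" w]
      by (auto simp: r_def dvd_eq_mod_eq_0 simp del: pos_mod_bound pos_mod_sign)
    have "(z \<otimes> x [^] (- (w div int d)), (w + (- (w div int d)) * int d) mod int n) \<in> H"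
      by (rule mult[OF zw pow[OF x]])
    moreover have "w + (- (w div int d)) * int d = r"
      using minus_div_mult_eq_mod[of w "int d"] by (simp add: r_def)
    ultimately have "D (nat r)"
      using r by (auto simp: D_def)
    then show False using least[of "nat r"] r by linarith
  qed
  \<comment> \<open>The identity lies over 0, which is also the residue of \<open>n\<close>.\<close>
  have "int d dvd int n" using dvd[of \<one> "int n"] one by simp
  then have "d dvd n" by simp
  then obtain e where e: "n = d * e" by (rule dvdE)
  then have e_pos: "0 < e" using n by simp
  interpret K: normal K G by (rule subgroup_imp_normal[OF K])
  \<comment> \<open>The \<open>e\<close>-th power of \<open>x\<close> lies over
    \<open>e * d = n\<close>, hence over 0, so it belongs to \<open>K\<close>; this is the condition
    \<open>C_pow\<close>.\<close>
  have "(x [^] e, 0) \<in> H"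
    using npow[OF x, of e] by (simp add: e mult.commute)
  then have "(K #> x) [^]\<^bsub>G Mod K\<^esub> e = K"
    using K.FactGroup_pow[OF xG] K.rcos_const[OF is_group] by (simp add: K_def)
  then have data: "cyclic_lift_data G K (K #> x) d e"
    using K xG d_pos e_pos by unfold_locales (auto simp: carrier_FactGroup)
  moreover have "H = cyclic_lift G K (K #> x) d e"
  proof (intro Set.set_eqI iffI)
    fix u assume u: "u \<in> H"
    obtain z w where zw: "u = (z, w)" by (cases u)
    have "w = w mod int n" using sub u zw by simp
    then have zw': "(z, w mod int n) \<in> H" using u zw by simp
    then obtain j where j: "w = j * int d" using dvd by (metis dvdE mult.commute)
    \<comment> \<open>Dividing by the power of \<open>x\<close> over the same residue moves the
      element into the fibre over 0, which is \<open>K\<close>.\<close>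
    have "(z \<otimes> x [^] (- j), (w + (- j) * int d) mod int n) \<in> H"
      by (rule mult[OF zw' pow[OF x]])
    then have "z \<otimes> inv (x [^] j) \<in> K"
      using xG by (simp add: K_def j int_pow_neg)
    then have "z \<in> K #> (x [^] j)"
      using K.rcos_module_rev[OF is_group] xG sub zw u by auto
    then show "u \<in> cyclic_lift G K (K #> x) d e"
      using zw j \<open>w = w mod int n\<close> K.FactGroup_int_pow[OF xG] e
      by (auto simp: cyclic_lift_def)
  next
    fix u assume "u \<in> cyclic_lift G K (K #> x) d e"
    then obtain z j where zj: "u = (z, (j * int d) mod int n)" "z \<in> K #> x [^] j"
      using K.FactGroup_int_pow[OF xG] e by (auto simp: cyclic_lift_def)
    then obtain y where y: "y \<in> K" "z = y \<otimes> x [^] j" by (auto simp: r_coset_def)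
    have "(y \<otimes> x [^] j, (0 + j * int d) mod int n) \<in> H"
      by (rule mult[OF _ pow[OF x]]) (use y in \<open>simp add: K_def\<close>)
    then show "u \<in> H" using zj y by simp
  qed
  ultimately show ?thesis using that e by blast
qed

section \<open>Counting the subgroups of the product by kernel and torsion\<close>

definition subgroups_of_order :: "('a, 'b) monoid_scheme \<Rightarrow> nat \<Rightarrow> 'a set set" where
  "subgroups_of_order G m = {H. subgroup H G \<and> card H = m}"

lemma finite_subgroups_of_order:
  "finite (carrier G) \<Longrightarrow> finite (subgroups_of_order G m)"
  by (rule finite_subset[of _ "Pow (carrier G)"]) (auto simp: subgroups_of_order_def subgroup_def)

definition torsion :: "('a, 'b) monoid_scheme \<Rightarrow> nat \<Rightarrow> 'a set" where
  "torsion G e = {x \<in> carrier G. x [^]\<^bsub>G\<^esub> e = \<one>\<^bsub>G\<^esub>}"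

text \<open>The lifts with \<open>d = n div e\<close> put the triples \<open>(e, K, C)\<close> in
  bijection with the subgroups. Injectivity recovers \<open>d\<close>, then \<open>e\<close>,
  \<open>K\<close> and \<open>C\<close> in turn; surjectivity is
  \<open>subgroup_eq_cyclic_lift\<close>.\<close>

proposition (in comm_group) card_subgroups_DirProd_cyclic:
  assumes fin: "finite (carrier G)" and n: "0 < n"
  shows "card (subgroups_of_order (G \<times>\<times> integer_mod_group n) N) =
    (\<Sum>e | e dvd n. \<Sum>K | subgroup K G \<and> card K * e = N. card (torsion (G Mod K) e))"
proof -
  let ?T = "SIGMA e:{e. e dvd n}. SIGMA K:{K. subgroup K G \<and> card K * e = N}. torsion (G Mod K) e"
  let ?f = "\<lambda>(e, K, C). cyclic_lift G K C (n div e) e"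
  have data: "cyclic_lift_data G K C (n div e) e" "n div e * e = n" "card K * e = N"
    if "(e, K, C) \<in> ?T" for e K C
  proof -
    have "e dvd n" using that by simp
    then have e: "0 < e" "0 < n div e"
      using n dvd_pos_nat[of n e] dvd_imp_le[of e n] by (simp_all add: div_greater_zero_iff)
    then show "cyclic_lift_data G K C (n div e) e"
      using that by (intro cyclic_lift_data.intro cyclic_lift_data_axioms.intro comm_group_axioms)
        (simp_all add: torsion_def)
  qed (use that in auto)
  have "bij_betw ?f ?T (subgroups_of_order (G \<times>\<times> integer_mod_group n) N)"
    unfolding bij_betw_def
  proof (intro conjI subset_antisym subsetI)
    show "inj_on ?f ?T"
    proof (rule inj_onI)
      fix u v assume uv: "u \<in> ?T" "v \<in> ?T" "?f u = ?f v"
      obtain e K C e' K' C' where uv_eq: "u = (e, K, C)" "v = (e', K', C')"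
        by (metis prod_cases3)
      have 1: "(e, K, C) \<in> ?T" and 2: "(e', K', C') \<in> ?T"
        using uv uv_eq by simp_all
      have eq: "cyclic_lift G K C (n div e) e = cyclic_lift G K' C' (n div e') e'"
        using uv uv_eq by simp
      interpret F: cyclic_lift_data G K C "n div e" e by (rule data(1)[OF 1])
      interpret F': cyclic_lift_data G K' C' "n div e'" e' by (rule data(1)[OF 2])
      note n = data(2)[OF 1] data(2)[OF 2]
      have d: "n div e = n div e'"
        using cyclic_lift_d_dvd[OF data(1)[OF 1] data(1)[OF 2]]
          cyclic_lift_d_dvd[OF data(1)[OF 2] data(1)[OF 1]] eq n
        by (simp add: dvd_antisym)
      then have "e = e'" using n F.d_pos by (metis mult_cancel_left not_less0)
      moreover have "K = K'" using F.cyclic_lift_K F'.cyclic_lift_K eq by simp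
      moreover have "C = C'"
        using F.cyclic_lift_C F'.cyclic_lift_C eq d by (simp only: \<open>e = e'\<close>)
      ultimately show "u = v" by (simp add: uv_eq)
    qed
  next
    fix H assume "H \<in> ?f ` ?T"
    then obtain e K C where T: "(e, K, C) \<in> ?T" and H: "H = cyclic_lift G K C (n div e) e" by auto
    interpret F: cyclic_lift_data G K C "n div e" e by (rule data(1)[OF T])
    show "H \<in> subgroups_of_order (G \<times>\<times> integer_mod_group n) N"
      using F.subgroup_cyclic_lift F.card_cyclic_lift[OF fin] data[OF T] H
      by (simp add: subgroups_of_order_def)
  next
    fix H assume "H \<in> subgroups_of_order (G \<times>\<times> integer_mod_group n) N"
    then have H: "subgroup H (G \<times>\<times> integer_mod_group n)" "card H = N"
      by (auto simp: subgroups_of_order_def)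
    obtain K C d e where de: "d * e = n" and F: "cyclic_lift_data G K C d e"
      and HF: "H = cyclic_lift G K C d e"
      by (rule subgroup_eq_cyclic_lift[OF n H(1)])
    interpret F: cyclic_lift_data G K C d e by (rule F)
    have "n div e = d" unfolding de[symmetric] using F.e_pos by simp
    moreover have "(e, K, C) \<in> ?T"
      using F.card_cyclic_lift[OF fin] HF H de F.subgroup_K F.C_carrier F.C_pow
      by (auto simp: torsion_def)
    ultimately show "H \<in> ?f ` ?T"
      using HF by (intro image_eqI[of _ _ "(e, K, C)"]) simp_all
  qed
  then have "card (subgroups_of_order (G \<times>\<times> integer_mod_group n) N) = card ?T"
    by (rule bij_betw_same_card[symmetric])
  also have "\<dots> = (\<Sum>e | e dvd n. \<Sum>K | subgroup K G \<and> card K * e = N. card (torsion (G Mod K) e))"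
  proof -
    have finK: "finite {K. subgroup K G \<and> P K}" for P
      by (rule finite_subset[of _ "Pow (carrier G)"]) (auto simp: subgroup_def fin)
    have "finite (torsion (G Mod K) e)" if "subgroup K G" for K e
      using fin by (auto simp: torsion_def carrier_FactGroup)
    then have "finite (SIGMA K:{K. subgroup K G \<and> card K * e = N}. torsion (G Mod K) e)"
      and "card (SIGMA K:{K. subgroup K G \<and> card K * e = N}. torsion (G Mod K) e) =
        (\<Sum>K | subgroup K G \<and> card K * e = N. card (torsion (G Mod K) e))" for e
      by (auto intro!: finite_SigmaI card_SigmaI finK)
    then show ?thesis
      using n by (simp add: card_SigmaI)
  qed
  finally show ?thesis .
qed

section \<open>Subgroups of small index and of small order\<close>

text \<open>Lagrange's relation replaces the count of cosets, so that passing between index and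
  order is pure arithmetic.\<close>

definition subgroups_of_index :: "('a, 'b) monoid_scheme \<Rightarrow> nat \<Rightarrow> 'a set set" where
  "subgroups_of_index G m = {H. subgroup H G \<and> card H * m = order G}"

lemma (in group) order_FactGroup:
  assumes "subgroup K G"
  shows "order (G Mod K) * card K = order G"
  using lagrange[OF assms] by (simp add: order_def FactGroup_def)

text \<open>A coset of \<open>K\<close> is killed by \<open>e\<close> exactly when the
  \<open>e\<close>-th power of any of its elements lies in \<open>K\<close>. The set is therefore
  the disjoint union of the torsion cosets, each of size \<open>card K\<close>. This reduces torsion
  in a quotient to a count in \<open>G\<close>.\<close>

lemma (in group) card_power_mem_subgroup:
  assumes "K \<lhd> G" and fin: "finite (carrier G)"
  shows "card {x \<in> carrier G. x [^] e \<in> K} = card K * card (torsion (G Mod K) e)"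
proof -
  interpret K: normal K G by fact
  have coset: "K #> x \<in> torsion (G Mod K) e \<longleftrightarrow> x [^] e \<in> K" if "x \<in> carrier G" for x
    using that K.FactGroup_pow[OF that, of e] K.rcos_const[OF is_group] K.is_subgroup
      coset_join1[of K "x [^] e"]
    by (auto simp: torsion_def carrier_FactGroup)
  have sub: "torsion (G Mod K) e \<subseteq> rcosets K"
    by (auto simp: torsion_def FactGroup_def)
  have "{x \<in> carrier G. x [^] e \<in> K} = \<Union> (torsion (G Mod K) e)"
  proof (intro Set.set_eqI iffI)
    fix x assume "x \<in> {x \<in> carrier G. x [^] e \<in> K}"
    then show "x \<in> \<Union> (torsion (G Mod K) e)"
      using coset rcos_self[OF _ K.is_subgroup] by blast
  next
    fix x assume "x \<in> \<Union> (torsion (G Mod K) e)"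
    then obtain y where y: "y \<in> carrier G" "K #> y \<in> torsion (G Mod K) e" "x \<in> K #> y"
      by (auto simp: torsion_def carrier_FactGroup)
    then have "x \<in> carrier G" "K #> x = K #> y"
      using repr_independence[OF _ _ K.is_subgroup] K.elemrcos_carrier[OF is_group] by auto
    then show "x \<in> {x \<in> carrier G. x [^] e \<in> K}"
      using coset[of x] y by simp
  qed
  moreover have "card K * card (torsion (G Mod K) e) = card (\<Union> (torsion (G Mod K) e))"
  proof (rule card_partition)
    show "finite (torsion (G Mod K) e)"
      using fin by (auto simp: torsion_def carrier_FactGroup)
    show "finite (\<Union> (torsion (G Mod K) e))"
      using finite_subset[OF Union_mono[OF sub]] rcosets_part_G[OF K.is_subgroup] fin by simp
    show "card c = card K" if "c \<in> torsion (G Mod K) e" for c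
      using card_rcosets_equal[OF subsetD[OF sub that] K.subset] by simp
    show "c \<inter> c' = {}" if "c \<in> torsion (G Mod K) e" "c' \<in> torsion (G Mod K) e" "c \<noteq> c'" for c c'
      using pairwiseD[OF rcos_disjoint[OF K.is_subgroup] subsetD[OF sub that(1)] subsetD[OF sub that(2)] that(3)]
      by (simp add: disjnt_def)
  qed
  ultimately show ?thesis by simp
qed

lemma torsion_eq_carrier:
  assumes "group G" "order G dvd e"
  shows "torsion G e = carrier G"
proof -
  interpret group G by fact
  obtain q where "e = order G * q" using assms(2) by (rule dvdE)
  then have "x [^]\<^bsub>G\<^esub> e = \<one>\<^bsub>G\<^esub>" if "x \<in> carrier G" for x
    using nat_pow_pow[OF that, of "order G" q] pow_order_eq_1[OF that] by simp
  then show ?thesis by (auto simp: torsion_def)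
qed

lemma order_DirProd_integer_mod_group:
  "0 < n \<Longrightarrow> order (G \<times>\<times> integer_mod_group n) = order G * n"
  by (simp add: order_def carrier_integer_mod_group card_cartesian_product)

lemma (in comm_group) card_subgroups_DirProd_primepow:
  assumes fin: "finite (carrier G)" and p: "prime p"
  shows "card (subgroups_of_order (G \<times>\<times> integer_mod_group (p ^ n)) N) =
    (\<Sum>t\<le>n. \<Sum>K | subgroup K G \<and> card K * p ^ t = N. card (torsion (G Mod K) (p ^ t)))"
proof -
  have "{e. e dvd p ^ n} = (\<lambda>t. p ^ t) ` {..n}"
    using p by (auto simp: divides_primepow_nat)
  moreover have "inj_on (\<lambda>t. p ^ t) {..n}"
    using prime_gt_1_nat[OF p] by (auto simp: inj_on_def)
  ultimately show ?thesis
    using card_subgroups_DirProd_cyclic[OF fin, of "p ^ n" N] prime_gt_0_nat[OF p]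
    by (simp add: sum.reindex)
qed

text \<open>A subgroup of index \<open>p ^ b\<close> has order \<open>order G * p ^ (n - b)\<close>.
  For \<open>e = p ^ t\<close> with \<open>t = n - b + j\<close>, the kernel has index
  \<open>p ^ j\<close> in \<open>G\<close>.\<close>

proposition (in comm_group) card_subgroups_of_index_DirProd:
  assumes fin: "finite (carrier G)" and p: "prime p" and b: "b \<le> n"
  shows "card (subgroups_of_index (G \<times>\<times> integer_mod_group (p ^ n)) (p ^ b)) =
    (\<Sum>j\<le>b. p ^ j * card (subgroups_of_index G (p ^ j)))"
proof -
  have p0: "0 < p" and p1: "1 < p" using p prime_gt_0_nat prime_gt_1_nat by auto
  define T where "T = (\<lambda>t. \<Sum>K | subgroup K G \<and> card K * p ^ t = order G * p ^ (n - b).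
                        card (torsion (G Mod K) (p ^ t)))"
  have "subgroups_of_index (G \<times>\<times> integer_mod_group (p ^ n)) (p ^ b) =
      subgroups_of_order (G \<times>\<times> integer_mod_group (p ^ n)) (order G * p ^ (n - b))"
  proof -
    have "order (G \<times>\<times> integer_mod_group (p ^ n)) = order G * p ^ (n - b) * p ^ b"
      using b p0 by (simp add: order_DirProd_integer_mod_group flip: power_add)
    then show ?thesis
      using p0 by (simp add: subgroups_of_index_def subgroups_of_order_def)
  qed
  then have "card (subgroups_of_index (G \<times>\<times> integer_mod_group (p ^ n)) (p ^ b)) = sum T {..n}"
    by (simp add: card_subgroups_DirProd_primepow[OF fin p] T_def)
  also have "\<dots> = sum T ((\<lambda>j. n - b + j) ` {..b})"
  proof (rule sum.mono_neutral_right)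
    show "(\<lambda>j. n - b + j) ` {..b} \<subseteq> {..n}" using b by auto
    show "\<forall>t\<in>{..n} - (\<lambda>j. n - b + j) ` {..b}. T t = 0"
    proof
      fix t assume t: "t \<in> {..n} - (\<lambda>j. n - b + j) ` {..b}"
      have "t < n - b"
      proof (rule ccontr)
        assume "\<not> t < n - b"
        then have "t = n - b + (t - (n - b))" "t - (n - b) \<le> b" using t by auto
        then show False using t by blast
      qed
      \<comment> \<open>For such \<open>t\<close> the kernel would need more elements than
        \<open>G\<close> has.\<close>
      then have lt: "p ^ t < p ^ (n - b)" using p1 by simp
      have "card K * p ^ t \<noteq> order G * p ^ (n - b)" if "subgroup K G" for K
      proof -
        have "card K \<le> order G"
          using fin subgroup.subset[OF that] by (simp add: order_def card_mono)
        moreover have "0 < order G"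
          using fin by (simp add: order_gt_0_iff_finite)
        ultimately have "card K * p ^ t < order G * p ^ (n - b)"
          using lt by (metis le_less_trans mult_le_mono1 mult_less_cancel1)
        then show ?thesis by simp
      qed
      then show "T t = 0" unfolding T_def by (intro sum.neutral) auto
    qed
  qed simp
  also have "\<dots> = (\<Sum>j\<le>b. T (n - b + j))"
    by (subst sum.reindex) auto
  also have "\<dots> = (\<Sum>j\<le>b. p ^ j * card (subgroups_of_index G (p ^ j)))"
  proof (rule sum.cong[OF refl])
    fix j assume j: "j \<in> {..b}"
    have set: "{K. subgroup K G \<and> card K * p ^ (n - b + j) = order G * p ^ (n - b)} =
        subgroups_of_index G (p ^ j)"
      using p0 by (auto simp: subgroups_of_index_def power_add)
    \<comment> \<open>The quotient has order \<open>p ^ j\<close>, which divides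
      \<open>e = p ^ (n - b + j)\<close>, so all its elements are torsion.\<close>
    have "card (torsion (G Mod K) (p ^ (n - b + j))) = p ^ j"
      if "K \<in> subgroups_of_index G (p ^ j)" for K
    proof -
      have K: "subgroup K G" "card K * p ^ j = order G" using that by (auto simp: subgroups_of_index_def)
      interpret K: normal K G by (rule subgroup_imp_normal[OF K(1)])
      have "order (G Mod K) * card K = order G" by (rule order_FactGroup[OF K(1)])
      moreover have "0 < order G" using fin by (simp add: order_gt_0_iff_finite)
      ultimately have o: "order (G Mod K) = p ^ j" using K(2)
        by (metis mult.commute mult_left_cancel not_less0 mult_0_right)
      then have "torsion (G Mod K) (p ^ (n - b + j)) = carrier (G Mod K)"
        by (intro torsion_eq_carrier K.factorgroup_is_group) (simp add: power_add)
      then show ?thesis using o by (simp add: order_def)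
    qed
    then show "T (n - b + j) = p ^ j * card (subgroups_of_index G (p ^ j))"
      by (simp add: T_def set)
  qed
  finally show ?thesis .
qed

text \<open>The torsion count enters as the hypothesis \<open>tors\<close>; for products of cyclic
  groups, \<open>card_torsion_cyclic_product\<close> supplies it with \<open>k\<close> the number of
  factors. Since \<open>p ^ t\<close> divides the order \<open>p ^ m\<close>, only \<open>t\<close>
  up to \<open>m\<close> contributes.\<close>

proposition (in comm_group) card_subgroups_of_order_DirProd:
  assumes fin: "finite (carrier G)" and p: "prime p" and m: "m \<le> n"
    and tors: "\<And>t K. t \<le> m \<Longrightarrow> K \<in> subgroups_of_order G (p ^ (m - t)) \<Longrightarrow>
                 card (torsion (G Mod K) (p ^ t)) = p ^ (k * t)"
  shows "card (subgroups_of_order (G \<times>\<times> integer_mod_group (p ^ n)) (p ^ m)) =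
    (\<Sum>t\<le>m. p ^ (k * t) * card (subgroups_of_order G (p ^ (m - t))))"
proof -
  have p0: "0 < p" and p1: "1 < p" using p prime_gt_0_nat prime_gt_1_nat by auto
  define T where "T = (\<lambda>t. \<Sum>K | subgroup K G \<and> card K * p ^ t = p ^ m.
                        card (torsion (G Mod K) (p ^ t)))"
  have "card (subgroups_of_order (G \<times>\<times> integer_mod_group (p ^ n)) (p ^ m)) = sum T {..n}"
    by (simp add: card_subgroups_DirProd_primepow[OF fin p] T_def)
  also have "\<dots> = sum T {..m}"
  proof (rule sum.mono_neutral_right)
    show "\<forall>t\<in>{..n} - {..m}. T t = 0"
    proof
      fix t assume "t \<in> {..n} - {..m}"
      then have lt: "p ^ m < p ^ t" using p1 by simp
      have "c * p ^ t \<noteq> p ^ m" for c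
        using lt p0 by (cases c) auto
      then show "T t = 0" by (simp add: T_def)
    qed
  qed (use m in auto)
  also have "\<dots> = (\<Sum>t\<le>m. p ^ (k * t) * card (subgroups_of_order G (p ^ (m - t))))"
  proof (rule sum.cong[OF refl])
    fix t assume t: "t \<in> {..m}"
    then have "p ^ m = p ^ (m - t) * p ^ t" by (simp flip: power_add)
    then have "{K. subgroup K G \<and> card K * p ^ t = p ^ m} = subgroups_of_order G (p ^ (m - t))"
      using p0 by (auto simp: subgroups_of_order_def)
    then show "T t = p ^ (k * t) * card (subgroups_of_order G (p ^ (m - t)))"
      using tors[of t] t by (simp add: T_def)
  qed
  finally show ?thesis .
qed

section \<open>Isomorphisms and splitting off the last factor\<close>

lemma card_subgroups_of_order_le:
  assumes f: "f \<in> iso G H" and G: "group G" and H: "group H" and fin: "finite (carrier H)"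
  shows "card (subgroups_of_order G m) \<le> card (subgroups_of_order H m)"
proof (rule card_inj_on_le)
  have inj: "inj_on f (carrier G)" using f by (simp add: iso_def bij_betw_def)
  have sub: "K \<subseteq> carrier G" if "K \<in> subgroups_of_order G m" for K
    using that subgroup.subset[of K G] by (simp add: subgroups_of_order_def)
  \<comment> \<open>Direct images under \<open>f\<close> separate subsets of the carrier and
    preserve both cardinality and the subgroup property; the reverse inequality will come from the
    inverse isomorphism.\<close>
  show "inj_on (image f) (subgroups_of_order G m)"
    using inj_on_image_eq_iff[OF inj sub sub] by (intro inj_onI) simp
  show "image f ` subgroups_of_order G m \<subseteq> subgroups_of_order H m"
  proof (intro image_subsetI)
    fix K assume K: "K \<in> subgroups_of_order G m"
    have "card (f ` K) = card K"
      using card_image inj_on_subset[OF inj sub[OF K]] by blast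
    then show "f ` K \<in> subgroups_of_order H m"
      using subgroup.iso_subgroup[OF _ G H f] K by (simp add: subgroups_of_order_def)
  qed
  show "finite (subgroups_of_order H m)" by (rule finite_subgroups_of_order[OF fin])
qed

lemma card_subgroups_of_order_iso:
  assumes f: "f \<in> iso G H" and G: "group G" and H: "group H" and fin: "finite (carrier G)"
  shows "card (subgroups_of_order G m) = card (subgroups_of_order H m)"
proof (rule antisym)
  have "finite (carrier H)"
    using f fin bij_betw_finite by (auto simp: iso_def)
  then show "card (subgroups_of_order G m) \<le> card (subgroups_of_order H m)"
    by (rule card_subgroups_of_order_le[OF f G H])
  show "card (subgroups_of_order H m) \<le> card (subgroups_of_order G m)"
    by (rule card_subgroups_of_order_le[OF group.iso_set_sym[OF G f] H G fin])
qed

text \<open>Elements of a product group are extensional functions, so the value at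
  \<open>Suc k\<close> must be erased by \<open>restrict\<close>; updating at \<open>Suc k\<close>
  is the inverse map.\<close>

lemma iso_product_group_Suc:
  "(\<lambda>x. (restrict x {1..k}, x (Suc k))) \<in>
     iso (product_group {1..Suc k} G) (product_group {1..k} G \<times>\<times> G (Suc k))"
proof (rule isoI)
  show "(\<lambda>x. (restrict x {1..k}, x (Suc k))) \<in> hom (product_group {1..Suc k} G) (product_group {1..k} G \<times>\<times> G (Suc k))"
    by (rule homI) (auto simp: PiE_def Pi_def)
  show "bij_betw (\<lambda>x. (restrict x {1..k}, x (Suc k))) (carrier (product_group {1..Suc k} G))
          (carrier (product_group {1..k} G \<times>\<times> G (Suc k)))"
  proof (rule bij_betw_byWitness[where f' = "\<lambda>(y, z). y(Suc k := z)"])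
    show "\<forall>x\<in>carrier (product_group {1..Suc k} G).
        (\<lambda>(y, z). y(Suc k := z)) (restrict x {1..k}, x (Suc k)) = x"
      by (auto simp: fun_eq_iff PiE_def extensional_def le_Suc_eq)
    show "(\<lambda>x. (restrict x {1..k}, x (Suc k))) ` carrier (product_group {1..Suc k} G)
        \<subseteq> carrier (product_group {1..k} G \<times>\<times> G (Suc k))"
      by (auto simp: PiE_iff)
  qed (auto simp: fun_eq_iff PiE_def extensional_def le_Suc_eq)
qed

section \<open>Products of cyclic p-groups\<close>

lemma subgroups_of_index_eq_subgroups_of_order:
  "0 < m \<Longrightarrow> m * l = order G \<Longrightarrow> subgroups_of_index G m = subgroups_of_order G l"
  unfolding subgroups_of_index_def subgroups_of_order_def by (metis mult.commute mult_left_cancel not_less0)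

lemma card_subgroups_of_index_iso:
  assumes "f \<in> iso G H" and "group G" and "group H" and "finite (carrier G)" and m: "0 < m"
  shows "card (subgroups_of_index G m) = card (subgroups_of_index H m)"
proof -
  have order: "order G = order H"
    using assms(1) by (auto simp: order_def iso_def bij_betw_same_card)
  show ?thesis
  proof (cases "m dvd order G")
    case True
    then obtain l where "order G = m * l" by (rule dvdE)
    then show ?thesis
      using card_subgroups_of_order_iso[OF assms(1-4), of l] order m
      by (simp add: subgroups_of_index_eq_subgroups_of_order[of m l])
  next
    case False
    then have "subgroups_of_index G m = {}" "subgroups_of_index H m = {}"
      using order unfolding subgroups_of_index_def by (metis (mono_tags, lifting) Collect_empty_eq dvd_triv_right)+
    then show ?thesis by simp
  qed
qed

text \<open>Needed for the product of no factors, from which both recursions start.\<close>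

lemma subgroup_trivial_iff:
  assumes "group G" and "order G = 1"
  shows "subgroup H G \<longleftrightarrow> H = carrier G"
proof
  interpret group G by fact
  obtain x where x: "carrier G = {x}" using assms(2) by (auto simp: order_def card_1_singleton_iff)
  show "H = carrier G" if "subgroup H G"
    using subgroup.subset[OF that] subgroup.one_closed[OF that] x by auto
  show "subgroup H G" if "H = carrier G" using that subgroup_self by simp
qed

section \<open>Order, powers and subgroup indices in \<open>cyclic_product\<close>\<close>

lemma comm_group_cyclic_product: "comm_group (cyclic_product p k a)"
proof (rule group.group_comm_groupI)
  show "group (cyclic_product p k a)" by (simp add: cyclic_product_def)
qed (auto simp: cyclic_product_def add.commute)

lemma carrier_cyclic_product:
  "0 < p \<Longrightarrow> carrier (cyclic_product p k a) = (\<Pi>\<^sub>E i\<in>{1..k}. {0..<int (p ^ a i)})"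
  by (simp add: cyclic_product_def carrier_integer_mod_group)

lemma finite_cyclic_product: "0 < p \<Longrightarrow> finite (carrier (cyclic_product p k a))"
  by (simp add: carrier_cyclic_product finite_PiE)

lemma order_cyclic_product: "0 < p \<Longrightarrow> order (cyclic_product p k a) = p ^ (\<Sum>i = 1..k. a i)"
  by (simp add: order_def carrier_cyclic_product card_PiE power_sum del: of_nat_power)

lemma pow_cyclic_product:
  fixes e :: nat
  assumes "x \<in> carrier (cyclic_product p k a)"
  shows "x [^]\<^bsub>cyclic_product p k a\<^esub> e = (\<lambda>i\<in>{1..k}. (int e * x i) mod int (p ^ a i))"
proof (induction e)
  case (Suc e)
  then show ?case
    by (auto simp: cyclic_product_def fun_eq_iff distrib_right mod_simps add.commute
        simp del: of_nat_power)
qed (simp add: cyclic_product_def)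

lemma iso_cyclic_product_Suc:
  "(\<lambda>x. (restrict x {1..k}, x (Suc k))) \<in> iso (cyclic_product p (Suc k) a)
     (cyclic_product p k a \<times>\<times> integer_mod_group (p ^ a (Suc k)))"
  unfolding cyclic_product_def by (rule iso_product_group_Suc)

lemma hsub_eq_card_subgroups_of_index:
  assumes "0 < p"
  shows "hsub k a b p = card (subgroups_of_index (cyclic_product p k a) (p ^ b))"
proof -
  interpret comm_group "cyclic_product p k a" by (rule comm_group_cyclic_product)
  have "card (rcosets\<^bsub>cyclic_product p k a\<^esub> H) = p ^ b \<longleftrightarrow>
      card H * p ^ b = order (cyclic_product p k a)" if H: "subgroup H (cyclic_product p k a)" for H
  proof -
    have "0 < order (cyclic_product p k a)" using assms by (simp add: order_cyclic_product)
    then have "0 < card H" using lagrange[OF H] by (metis gr0I mult_0_right)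
    then show ?thesis using lagrange[OF H]
      by (metis mult.commute mult_left_cancel not_less0)
  qed
  then show ?thesis unfolding hsub_def subgroups_of_index_def by metis
qed

section \<open>Torsion in quotients of products of cyclic groups\<close>

lemma card_dvd_multiples_mod:
  fixes y :: int and c n :: nat
  assumes c: "0 < c" and n: "0 < n" and y: "0 \<le> y" "y < int (c * n)" "int c dvd y"
  shows "card {v \<in> {0..<int (c * n)}. (int c * v) mod int (c * n) = y} = c"
proof -
  obtain u where u: "y = int c * u" using y(3) by (rule dvdE)
  have u0: "0 \<le> u" "u < int n" using y c by (auto simp: u zero_le_mult_iff)
  let ?f = "\<lambda>q. u + int n * int q"
  \<comment> \<open>Cancelling \<open>c\<close> leaves a congruence modulo \<open>n\<close>, which
    has one solution in each of the \<open>c\<close> blocks of length \<open>n\<close>.\<close>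
  have eq: "(int c * v) mod int (c * n) = y \<longleftrightarrow> v mod int n = u" for v
    using c by (simp add: u)
  have "{v \<in> {0..<int (c * n)}. (int c * v) mod int (c * n) = y} = ?f ` {..<c}"
  proof (intro Set.set_eqI iffI)
    fix v assume "v \<in> {v \<in> {0..<int (c * n)}. (int c * v) mod int (c * n) = y}"
    then have v: "0 \<le> v" "v < int c * int n" "v mod int n = u" using eq by auto
    have "0 \<le> v div int n" using v n by (simp add: pos_imp_zdiv_nonneg_iff)
    moreover have "v div int n < int c"
    proof -
      have "v div int n * int n \<le> v"
        using n minus_mod_eq_div_mult[of v "int n"] pos_mod_sign[of "int n" v] by linarith
      then have "v div int n * int n < int c * int n" using v by linarith
      then show ?thesis using n by (simp add: mult_less_cancel_right)
    qed
    moreover have "v = u + int n * (v div int n)" using v by auto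
    ultimately show "v \<in> ?f ` {..<c}"
      by (intro image_eqI[of _ _ "nat (v div int n)"]) auto
  next
    fix v assume "v \<in> ?f ` {..<c}"
    then obtain q where q: "q < c" "v = u + int n * int q" by auto
    have "int n * int q + int n \<le> int n * int c"
      using q(1) mult_left_mono[of "int q + 1" "int c" "int n"] by (simp add: algebra_simps)
    then have "v < int (c * n)" using u0 q(2) by (simp add: mult.commute)
    then show "v \<in> {v \<in> {0..<int (c * n)}. (int c * v) mod int (c * n) = y}"
      using q u0 unfolding mem_Collect_eq eq by simp
  qed
  moreover have "inj_on ?f {..<c}" using n by (auto simp: inj_on_def)
  ultimately show ?thesis by (simp add: card_image)
qed

lemma (in group) subgroup_pow_card:
  assumes "subgroup H G" and "x \<in> H"
  shows "x [^] card H = \<one>"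
proof -
  interpret H: group "G\<lparr>carrier := H\<rparr>" by (rule subgroup_imp_group[OF assms(1)])
  show ?thesis
    using H.pow_order_eq_1[of x] assms(2) by (simp add: order_def flip: nat_pow_consistent)
qed

text \<open>By \<open>card_power_mem_subgroup\<close> it suffices to count the \<open>x\<close>
  whose \<open>p ^ t\<close>-th power lies in \<open>K\<close>. They are partitioned by the value
  \<open>y\<close> of that power, and every fibre \<open>F y\<close> has \<open>p ^ (k * t)\<close>
  elements.\<close>

lemma card_torsion_cyclic_product:
  assumes p: "0 < p" and a: "\<forall>i\<in>{1..k}. m \<le> a i" and t: "t \<le> m"
    and K: "K \<in> subgroups_of_order (cyclic_product p k a) (p ^ (m - t))"
  shows "card (torsion (cyclic_product p k a Mod K) (p ^ t)) = p ^ (k * t)"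
proof -
  let ?G = "cyclic_product p k a"
  interpret comm_group ?G by (rule comm_group_cyclic_product)
  have sK: "subgroup K ?G" and cK: "card K = p ^ (m - t)"
    using K by (auto simp: subgroups_of_order_def)
  have fin: "finite (carrier ?G)" by (rule finite_cyclic_product[OF p])
  have finK: "finite K" using subgroup.subset[OF sK] fin by (rule finite_subset)
  define F where "F y = {x \<in> carrier ?G. x [^]\<^bsub>?G\<^esub> (p ^ t) = y}" for y
  have cF: "card (F y) = p ^ (k * t)" if y: "y \<in> K" for y
  proof -
    have yc: "y \<in> carrier ?G" using subgroup.subset[OF sK] y by blast
    have yi: "0 \<le> y i" "y i < int (p ^ a i)" "int (p ^ t) dvd y i" if i: "i \<in> {1..k}" for i
    proof -
      show "0 \<le> y i" "y i < int (p ^ a i)"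
        using yc i by (auto simp: carrier_cyclic_product[OF p] PiE_iff)
      \<comment> \<open>The order \<open>p ^ (m - t)\<close> of \<open>K\<close> kills
        \<open>y\<close>. As \<open>m\<close> is at most \<open>a i\<close>, it follows that
        \<open>p ^ m\<close> divides \<open>p ^ (m - t) * y i\<close>, so each coordinate of
        \<open>y\<close> is divisible by \<open>p ^ t\<close>.\<close>
      have "y [^]\<^bsub>?G\<^esub> (p ^ (m - t)) = \<one>\<^bsub>?G\<^esub>"
        using subgroup_pow_card[OF sK y] by (simp add: cK)
      then have "(\<lambda>i\<in>{1..k}. (int (p ^ (m - t)) * y i) mod int (p ^ a i)) i = (\<lambda>i\<in>{1..k}. 0) i"
        unfolding pow_cyclic_product[OF yc] by (simp add: cyclic_product_def)
      then have "(int (p ^ (m - t)) * y i) mod int (p ^ a i) = 0"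
        using i by (simp only: restrict_apply if_True)
      then have "int (p ^ a i) dvd int (p ^ (m - t)) * y i" by (rule mod_0_imp_dvd)
      moreover have "int (p ^ (m - t) * p ^ t) dvd int (p ^ a i)"
        using a i t by (simp add: le_imp_power_dvd flip: power_add)
      ultimately have "int (p ^ (m - t)) * int (p ^ t) dvd int (p ^ (m - t)) * y i"
        by (metis dvd_trans of_nat_mult)
      then show "int (p ^ t) dvd y i" using p by simp
    qed
    \<comment> \<open>Powers are taken coordinatewise, so the fibre is a product of solution sets,
      each of size \<open>p ^ t\<close> by \<open>card_dvd_multiples_mod\<close> with modulus
      \<open>p ^ t * p ^ (a i - t)\<close>.\<close>
    have "F y = (\<Pi>\<^sub>E i\<in>{1..k}. {v \<in> {0..<int (p ^ a i)}. (int (p ^ t) * v) mod int (p ^ a i) = y i})"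
    proof (intro Set.set_eqI)
      fix x
      have "(\<lambda>i\<in>{1..k}. (int (p ^ t) * x i) mod int (p ^ a i)) = y \<longleftrightarrow>
          (\<forall>i\<in>{1..k}. (int (p ^ t) * x i) mod int (p ^ a i) = y i)"
        using yc by (auto simp: carrier_cyclic_product[OF p] PiE_iff extensional_def fun_eq_iff)
      then show "x \<in> F y \<longleftrightarrow> x \<in> (\<Pi>\<^sub>E i\<in>{1..k}. {v \<in> {0..<int (p ^ a i)}. (int (p ^ t) * v) mod int (p ^ a i) = y i})"
        using pow_cyclic_product[of x p k a "p ^ t"]
        by (auto simp: F_def carrier_cyclic_product[OF p] PiE_iff)
    qed
    then have "card (F y) =
        (\<Prod>i\<in>{1..k}. card {v \<in> {0..<int (p ^ a i)}. (int (p ^ t) * v) mod int (p ^ a i) = y i})"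
      by (simp add: card_PiE)
    also have "\<dots> = (\<Prod>i\<in>{1..k}. p ^ t)"
    proof (rule prod.cong[OF refl])
      fix i assume i: "i \<in> {1..k}"
      then have "p ^ a i = p ^ t * p ^ (a i - t)"
        using bspec[OF a i] t by (simp flip: power_add)
      then show "card {v \<in> {0..<int (p ^ a i)}. (int (p ^ t) * v) mod int (p ^ a i) = y i} = p ^ t"
        using card_dvd_multiples_mod[of "p ^ t" "p ^ (a i - t)" "y i"] yi[OF i] p by simp
    qed
    finally show ?thesis by (simp add: mult.commute flip: power_mult)
  qed
  have "{x \<in> carrier ?G. x [^]\<^bsub>?G\<^esub> (p ^ t) \<in> K} = (\<Union>y\<in>K. F y)"
    by (auto simp: F_def)
  moreover have "card (\<Union>y\<in>K. F y) = (\<Sum>y\<in>K. card (F y))"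
    using finK fin by (intro card_UN_disjoint) (auto simp: F_def)
  moreover have "(\<Sum>y\<in>K. card (F y)) = card K * p ^ (k * t)"
    using cF by simp
  ultimately have "card K * card (torsion (?G Mod K) (p ^ t)) = card K * p ^ (k * t)"
    using card_power_mem_subgroup[OF subgroup_imp_normal[OF sK] fin, of "p ^ t"] by presburger
  then show ?thesis using p by (simp add: cK)
qed

section \<open>Recursions in the number of factors\<close>

lemma card_subgroups_of_index_cyclic_product_Suc:
  assumes p: "prime p" and b: "b \<le> a (Suc k)"
  shows "card (subgroups_of_index (cyclic_product p (Suc k) a) (p ^ b)) =
    (\<Sum>j\<le>b. p ^ j * card (subgroups_of_index (cyclic_product p k a) (p ^ j)))"
proof -
  have p0: "0 < p" using p by (rule prime_gt_0_nat)
  interpret A: comm_group "cyclic_product p k a" by (rule comm_group_cyclic_product)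
  interpret B: comm_group "cyclic_product p (Suc k) a" by (rule comm_group_cyclic_product)
  show ?thesis
    using card_subgroups_of_index_iso[OF iso_cyclic_product_Suc B.is_group
        DirProd_group[OF A.is_group group_integer_mod_group] finite_cyclic_product[OF p0], of "p ^ b"] p0
      A.card_subgroups_of_index_DirProd[OF finite_cyclic_product[OF p0] p b] by simp
qed

lemma card_subgroups_of_order_cyclic_product_Suc:
  assumes p: "prime p" and a: "\<forall>i\<in>{1..Suc k}. m \<le> a i"
  shows "card (subgroups_of_order (cyclic_product p (Suc k) a) (p ^ m)) =
    (\<Sum>t\<le>m. p ^ (k * t) * card (subgroups_of_order (cyclic_product p k a) (p ^ (m - t))))"
proof -
  have p0: "0 < p" using p by (rule prime_gt_0_nat)
  interpret A: comm_group "cyclic_product p k a" by (rule comm_group_cyclic_product)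
  interpret B: comm_group "cyclic_product p (Suc k) a" by (rule comm_group_cyclic_product)
  have "m \<le> a (Suc k)" "\<forall>i\<in>{1..k}. m \<le> a i" using a by auto
  then show ?thesis
    using card_subgroups_of_order_iso[OF iso_cyclic_product_Suc B.is_group
        DirProd_group[OF A.is_group group_integer_mod_group] finite_cyclic_product[OF p0]]
      A.card_subgroups_of_order_DirProd[OF finite_cyclic_product[OF p0] p,
        OF _ card_torsion_cyclic_product[OF p0]] by simp
qed

section \<open>Gaussian binomials and the q-Pascal identities\<close>

text \<open>The Gaussian binomial coefficient $\binom{b+k-1}{k-1}_q$.\<close>

definition gauss_prod :: "real \<Rightarrow> nat \<Rightarrow> nat \<Rightarrow> real" where
  "gauss_prod q k b = (\<Prod>i = 2..k. (q ^ (b + i - 1) - 1) / (q ^ (i - 1) - 1))"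

lemma gauss_prod_1 [simp]: "gauss_prod q (Suc 0) b = 1"
  by (simp add: gauss_prod_def)

lemma gauss_prod_0 [simp]:
  assumes "1 < q" shows "gauss_prod q k 0 = 1"
  unfolding gauss_prod_def
proof (intro prod.neutral ballI)
  fix i assume "i \<in> {2..k}"
  then have "1 < q ^ (i - 1)" using assms by (intro one_less_power) auto
  then show "(q ^ (0 + i - 1) - 1) / (q ^ (i - 1) - 1) = 1" by simp
qed

lemma gauss_prod_Suc:
  "1 \<le> k \<Longrightarrow> gauss_prod q (Suc k) b = gauss_prod q k b * (q ^ (b + k) - 1) / (q ^ k - 1)"
  by (simp add: gauss_prod_def)

text \<open>With the extra factor \<open>q ^ Suc b - 1\<close>, the left side has the numerators
  \<open>q ^ (b + 1) - 1, ..., q ^ (b + k) - 1\<close> of \<open>gauss_prod q (Suc k) b\<close>; on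
  the right, \<open>q ^ k - 1\<close> cancels the last denominator.\<close>

lemma gauss_prod_shift:
  assumes q: "1 < q" and "1 \<le> k"
  shows "gauss_prod q k (Suc b) * (q ^ Suc b - 1) = gauss_prod q (Suc k) b * (q ^ k - 1)"
  using assms(2)
proof (induction k rule: dec_induct)
  case (step k)
  have nz: "q ^ k - 1 \<noteq> 0" "q ^ Suc k - 1 \<noteq> 0"
    using one_less_power[OF q, of k] one_less_power[OF q, of "Suc k"] step by auto
  have "gauss_prod q (Suc k) (Suc b) * (q ^ Suc b - 1) =
      gauss_prod q k (Suc b) * (q ^ Suc b - 1) * (q ^ (Suc b + k) - 1) / (q ^ k - 1)"
    using step by (simp only: gauss_prod_Suc) (simp add: ac_simps)
  also have "\<dots> = gauss_prod q (Suc k) b * (q ^ (b + Suc k) - 1)"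
    unfolding step.IH using nz by (simp add: ac_simps)
  also have "\<dots> = gauss_prod q (Suc (Suc k)) b * (q ^ Suc k - 1)"
    using nz step by (simp only: gauss_prod_Suc[of "Suc k"]) simp
  finally show ?case .
qed (use q in \<open>simp add: gauss_prod_Suc\<close>)

text \<open>All terms are multiples of \<open>X\<close> over the denominator
  \<open>q ^ k - 1\<close>. With \<open>u = q ^ Suc b\<close> and \<open>v = q ^ k\<close>, the
  identities become \<open>u * v - 1 = (u - 1) + u * (v - 1)\<close> and
  \<open>u * v - 1 = (v - 1) + v * (u - 1)\<close>.\<close>

lemma gauss_prod_pascal:
  assumes q: "1 < q" and k: "1 \<le> k"
  shows "gauss_prod q (Suc k) (Suc b) = gauss_prod q (Suc k) b + q ^ Suc b * gauss_prod q k (Suc b)"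
    and "gauss_prod q (Suc k) (Suc b) = gauss_prod q k (Suc b) + q ^ k * gauss_prod q (Suc k) b"
proof -
  have nz: "q ^ k - 1 \<noteq> 0" using one_less_power[OF q, of k] k by auto
  define X where "X = gauss_prod q k (Suc b)"
  have Y: "gauss_prod q (Suc k) b = X * (q ^ Suc b - 1) / (q ^ k - 1)"
    using gauss_prod_shift[OF q k, of b] nz by (simp add: X_def field_simps)
  have Z: "gauss_prod q (Suc k) (Suc b) = X * (q ^ Suc b * q ^ k - 1) / (q ^ k - 1)"
    using gauss_prod_Suc[OF k, of q "Suc b"] by (simp only: X_def power_add)
  show "gauss_prod q (Suc k) (Suc b) = gauss_prod q (Suc k) b + q ^ Suc b * gauss_prod q k (Suc b)"
    unfolding Y Z X_def[symmetric] using nz by (simp add: field_simps)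
  show "gauss_prod q (Suc k) (Suc b) = gauss_prod q k (Suc b) + q ^ k * gauss_prod q (Suc k) b"
    unfolding Y Z X_def[symmetric] using nz by (simp add: field_simps)
qed

text \<open>Solves the recursion for small index: the first Pascal form adds the top
  summand.\<close>

lemma sum_gauss_prod:
  assumes q: "1 < q" and k: "1 \<le> k"
  shows "(\<Sum>j\<le>b. q ^ j * gauss_prod q k j) = gauss_prod q (Suc k) b"
  by (induction b) (simp_all add: q gauss_prod_pascal(1)[OF q k])

text \<open>Solves the recursion for small order: after the summand \<open>t = 0\<close> is split
  off, the rest is \<open>q ^ k\<close> times the sum for \<open>b\<close>, as in the second Pascal
  form.\<close>

lemma sum_gauss_prod_reverse:
  assumes q: "1 < q" and k: "1 \<le> k"
  shows "(\<Sum>t\<le>b. q ^ (k * t) * gauss_prod q k (b - t)) = gauss_prod q (Suc k) b"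
proof (induction b)
  case (Suc b)
  have "(\<Sum>t\<le>Suc b. q ^ (k * t) * gauss_prod q k (Suc b - t)) =
      gauss_prod q k (Suc b) + q ^ k * (\<Sum>t\<le>b. q ^ (k * t) * gauss_prod q k (b - t))"
    by (simp only: sum.atMost_Suc_shift sum_distrib_left) (simp add: power_add mult.assoc)
  then show ?case
    by (simp only: Suc gauss_prod_pascal(2)[OF q k])
qed (simp add: q)

section \<open>Closed formulas for small index and small order\<close>

lemma card_subgroups_of_index_cyclic_product:
  assumes p: "prime p" and k: "1 \<le> k" and a: "\<forall>i\<in>{1..k}. b \<le> a i"
  shows "real (card (subgroups_of_index (cyclic_product p k a) (p ^ b))) = gauss_prod (real p) k b"
  using k a
proof (induction k arbitrary: b rule: dec_induct)
  case base
  have p0: "0 < p" and p1: "1 < p" using p prime_gt_0_nat prime_gt_1_nat by auto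
  \<comment> \<open>The summation formulas need \<open>1 <= k\<close>, so the induction starts at
    \<open>k = 1\<close>. That case is read off from the recursion over the trivial group, where
    only the summand \<open>j = 0\<close> survives.\<close>
  have "group (cyclic_product p 0 a)" "order (cyclic_product p 0 a) = 1"
    using comm_group_cyclic_product[of p 0 a] p0
    by (simp_all add: order_cyclic_product comm_group_def)
  then have "subgroups_of_index (cyclic_product p 0 a) (p ^ j) =
      (if j = 0 then {carrier (cyclic_product p 0 a)} else {})" for j
    using p1 by (auto simp: subgroups_of_index_def subgroup_trivial_iff simp flip: order_def)
  then have "p ^ j * card (subgroups_of_index (cyclic_product p 0 a) (p ^ j)) = (if j = 0 then 1 else 0)" for j
    by simp
  then show ?case
    using card_subgroups_of_index_cyclic_product_Suc[OF p, of b a 0] base by simp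
next
  case (step k)
  have q: "1 < real p" using prime_gt_1_nat[OF p] by simp
  \<comment> \<open>The recursion draws on all smaller exponents \<open>j\<close>, hence the
    induction with \<open>b\<close> arbitrary.\<close>
  have "real (card (subgroups_of_index (cyclic_product p k a) (p ^ j))) = gauss_prod (real p) k j"
    if "j \<le> b" for j
    using step.IH[of j] step.prems that by (simp add: le_SucI order_trans[OF that])
  then show ?case
    using card_subgroups_of_index_cyclic_product_Suc[OF p, of b a k] step
      sum_gauss_prod[OF q, of k b] by simp
qed

lemma card_subgroups_of_order_cyclic_product:
  assumes p: "prime p" and k: "1 \<le> k" and a: "\<forall>i\<in>{1..k}. m \<le> a i"
  shows "real (card (subgroups_of_order (cyclic_product p k a) (p ^ m))) = gauss_prod (real p) k m"
  using k a
proof (induction k arbitrary: m rule: dec_induct)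
  case base
  have p0: "0 < p" and p1: "1 < p" using p prime_gt_0_nat prime_gt_1_nat by auto
  have "group (cyclic_product p 0 a)" "order (cyclic_product p 0 a) = 1"
    using comm_group_cyclic_product[of p 0 a] p0
    by (simp_all add: order_cyclic_product comm_group_def)
  then have "subgroups_of_order (cyclic_product p 0 a) (p ^ j) =
      {H. H = carrier (cyclic_product p 0 a) \<and> p ^ j = 1}" for j
    unfolding subgroups_of_order_def by (auto simp: subgroup_trivial_iff order_def)
  \<comment> \<open>Over the trivial group only \<open>t = m\<close> contributes, with weight
    \<open>p ^ (0 * m) = 1\<close>.\<close>
  then have "card (subgroups_of_order (cyclic_product p 0 a) (p ^ (m - t))) = (if t = m then 1 else 0)"
    if "t \<le> m" for t
    using that p1 by simp
  then show ?case
    using card_subgroups_of_order_cyclic_product_Suc[OF p, of 0 m a] base by simp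
next
  case (step k)
  have q: "1 < real p" using prime_gt_1_nat[OF p] by simp
  have "real (card (subgroups_of_order (cyclic_product p k a) (p ^ (m - t)))) = gauss_prod (real p) k (m - t)" for t
    using step.IH[of "m - t"] step.prems by (simp add: le_SucI le_diff_conv trans_le_add1)
  then show ?case
    using card_subgroups_of_order_cyclic_product_Suc[OF p, of k m a] step
      sum_gauss_prod_reverse[OF q, of k m] by simp
qed

theorem theorem4p1:
  fixes p k b :: nat and a :: "nat \<Rightarrow> nat"
  assumes "prime p"
    and "k \<ge> 1"
    and "1 \<le> a 1"
    and "\<forall>i j. 1 \<le> i \<longrightarrow> i \<le> j \<longrightarrow> j \<le> k \<longrightarrow> a i \<le> a j"
  shows "(b \<le> a 1 \<longrightarrow>
            real (hsub k a b p) =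
              (\<Prod>i = 2..k. (real p ^ (b + i - 1) - 1) / (real p ^ (i - 1) - 1))) \<and>
         ((\<Sum>i = 2..k. a i) \<le> b \<and> b \<le> (\<Sum>i = 1..k. a i) \<longrightarrow>
            real (hsub k a b p) =
              (\<Prod>i = 2..k. (real p ^ ((\<Sum>j = 1..k. a j) - b + i - 1) - 1)
                           / (real p ^ (i - 1) - 1)))"
proof (intro conjI impI)
  have p0: "0 < p" using assms(1) by (rule prime_gt_0_nat)
  \<comment> \<open>As the exponents are sorted, a bound by \<open>a 1\<close> is a bound by every
    \<open>a i\<close>.\<close>
  have a1: "a 1 \<le> a i" if "i \<in> {1..k}" for i using assms(4) that by auto
  show "real (hsub k a b p) = (\<Prod>i = 2..k. (real p ^ (b + i - 1) - 1) / (real p ^ (i - 1) - 1))"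
    if "b \<le> a 1"
  proof -
    have "\<forall>i\<in>{1..k}. b \<le> a i" using a1 that order_trans by blast
    from card_subgroups_of_index_cyclic_product[OF assms(1,2) this]
    show ?thesis by (simp only: hsub_eq_card_subgroups_of_index[OF p0] gauss_prod_def)
  qed
  assume b: "(\<Sum>i = 2..k. a i) \<le> b \<and> b \<le> (\<Sum>i = 1..k. a i)"
  \<comment> \<open>Index \<open>p ^ b\<close> means order \<open>p ^ m\<close>, and the lower bound
    on \<open>b\<close> says precisely that \<open>m\<close> is at most \<open>a 1\<close>.\<close>
  define m where "m = (\<Sum>i = 1..k. a i) - b"
  have "(\<Sum>i = 1..k. a i) = a 1 + (\<Sum>i = 2..k. a i)"
    using assms(2) by (simp add: sum.atLeast_Suc_atMost numeral_2_eq_2)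
  then have "m \<le> a 1" using b unfolding m_def by linarith
  then have m: "\<forall>i\<in>{1..k}. m \<le> a i" using a1 order_trans by blast
  have "p ^ b * p ^ m = order (cyclic_product p k a)"
    using b by (simp add: order_cyclic_product[OF p0] m_def flip: power_add)
  then have "hsub k a b p = card (subgroups_of_order (cyclic_product p k a) (p ^ m))"
    using p0 by (simp add: hsub_eq_card_subgroups_of_index subgroups_of_index_eq_subgroups_of_order)
  then show "real (hsub k a b p) =
      (\<Prod>i = 2..k. (real p ^ ((\<Sum>j = 1..k. a j) - b + i - 1) - 1) / (real p ^ (i - 1) - 1))"
    using card_subgroups_of_order_cyclic_product[OF assms(1,2) m]
    by (simp only: gauss_prod_def m_def)
qed

end
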